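(* Let $(\mathfrak a,[\cdot,\cdot]_{\mathfrak a},\omega_{\mathfrak a})$ be a symplectic Lie algebra, $(\mathcal B,[\cdot,\cdot]_{\mathcal B})$ a Lie algebra, $\rho_1:\mathfrak a\to\mathfrak{gl}(\mathcal B^* )$ a representation and $\psi\in\mathcal Z^2(\mathfrak a,\rho_1)$ a $2$-cocycle. Let $\pi_1:\mathfrak a\to\mathfrak{gl}(\mathcal B)$, $\pi_2:\mathcal B\to\mathfrak{gl}(\mathfrak a)$, $\rho_2:\mathcal B\to\mathfrak{gl}(\mathcal B^* )$ be linear maps, $\Phi_1:\mathcal B\times\mathcal B\to\mathfrak a$, $\Phi_2:\mathcal B\times\mathcal B\to\mathcal B^*$ skew-symmetric bilinear maps and $\Omega:\mathcal B\times\mathfrak a\to\mathcal B^*$ a bilinear map. Endow $\mathfrak g=\mathcal B\oplus\mathfrak a\oplus\mathcal B^*$ with the skew-symmetric bracket given, for $a,a_1,a_2\in\mathfrak a$, $b,b_1,b_2\in\mathcal B$, $f\in\mathcal B^*$, by $[b_1,b_2]=[b_1,b_2]_{\mathcal B}+\Phi_1(b_1,b_2)+\Phi_2(b_1,b_2)$, $[a_1,a_2]=[a_1,a_2]_{\mathfrak a}+\psi(a_1,a_2)$, $[a,f]=\rho_1(a)(f)$, $[b,f]=\rho_2(b)(f)$, $[b,a]=-\pi_1(a)(b)+\pi_2(b)(a)+\Omega(b,a)$, and $[\mathcal B^*,\mathcal B^*]=0$. Then $(\mathfrak g,[\cdot,\cdot])$ is a Lie algebra if and only if the following five conditions hold for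 all $a,a_1,a_2\in\mathfrak a$ and $b,b_1,b_2,b_3\in\mathcal B$ (where $\sum_\circlearrowright$ is the cyclic sum over $(b_1,b_2,b_3)$): (C1) $[\rho_1(a),\rho_2(b)]=\rho_2(\pi_1(a)(b))-\rho_1(\pi_2(b)(a))$; (C2) $\sum_\circlearrowright\pi_1(\Phi_1(b_1,b_2))(b_3)=0$; $\ \sum_\circlearrowright\Phi_1(b_1,[b_2,b_3]_{\mathcal B})=-\sum_\circlearrowright\pi_2(b_1)(\Phi_1(b_2,b_3))$; $\ \sum_\circlearrowright\Phi_2(b_1,[b_2,b_3]_{\mathcal B})=-\sum_\circlearrowright\rho_2(b_1)(\Phi_2(b_2,b_3))-\sum_\circlearrowright\Omega(b_1,\Phi_1(b_2,b_3))$; (C3) $\pi_1(a)([b_1,b_2]_{\mathcal B})-[\pi_1(a)(b_1),b_2]_{\mathcal B}-[b_1,\pi_1(a)(b_2)]_{\mathcal B}=\pi_1(\pi_2(b_2)(a))(b_1)-\pi_1(\pi_2(b_1)(a))(b_2)$; $\Phi_1(\pi_1(a)(b_1),b_2)+\Phi_1(b_1,\pi_1(a)(b_2))-[a,\Phi_1(b_1,b_2)]_{\mathfrak a}=[\pi_2(b_1),\pi_2(b_2)](a)-\pi_2([b_1,b_2]_{\mathcal B})(a)$; $\psi(a,\Phi_1(b_1,b_2))+\rho_2(b_1)(\Omega(b_2,a))-\rho_2(b_2)(\Omega(b_1,a))=\Phi_2(\pi_1(a)(b_1),b_2)+\Phi_2(b_1,\pi_1(a)(b_2))-\rho_1(a)(\Phi_2(b_1,b_2))+\Omega([b_1,b_2]_{\mathcal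 B},a)-\Omega(b_1,\pi_2(b_2)(a))+\Omega(b_2,\pi_2(b_1)(a))$; (C4) $[\rho_2(b_1),\rho_2(b_2)]-\rho_2([b_1,b_2]_{\mathcal B})=\rho_1(\Phi_1(b_1,b_2))$; (C5) $\pi_1$ is a representation of $\mathfrak a$; $\pi_2(b)([a_1,a_2]_{\mathfrak a})-[\pi_2(b)(a_1),a_2]_{\mathfrak a}-[a_1,\pi_2(b)(a_2)]_{\mathfrak a}=\pi_2(\pi_1(a_2)(b))(a_1)-\pi_2(\pi_1(a_1)(b))(a_2)$; $\psi(\pi_2(b)(a_1),a_2)+\psi(a_1,\pi_2(b)(a_2))-\rho_2(b)(\psi(a_1,a_2))=\rho_1(a_2)(\Omega(b,a_1))-\rho_1(a_1)(\Omega(b,a_2))+\Omega(b,[a_1,a_2]_{\mathfrak a})+\Omega(\pi_1(a_1)(b),a_2)-\Omega(\pi_1(a_2)(b),a_1)$.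
   Context: All Lie algebras are real and finite-dimensional. A symplectic Lie algebra is a Lie algebra with a nondegenerate skew-symmetric bilinear form $\omega$ satisfying $\omega([x,y],z)+\omega([y,z],x)+\omega([z,x],y)=0$. Brackets of endomorphisms are commutators. For a representation $\rho_1$ of $\mathfrak a$ on $V$, $\mathcal Z^2(\mathfrak a,\rho_1)$ is the space of skew-symmetric bilinear maps $\psi:\mathfrak a\times\mathfrak a\to V$ with $\sum_{\circlearrowright(x,y,z)}\big(\rho_1(x)(\psi(y,z))+\psi(x,[y,z]_{\mathfrak a})\big)=0$ (cyclic sum). *)

theory Defs
  imports "HOL-Analysis.Analysis"
begin

section \<open>Lie algebras, representations, cocycles\<close>

text \<open>
  All vector spaces are real; a vector space is a type of class \<open>real_vector\<close>, and the
  structure on it is passed around as explicit operations.  Lie algebras are finite-dimensional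
  by convention; the zero space is allowed.
\<close>

definition finite_dimensional :: "'v::real_vector itself \<Rightarrow> bool" where
  "finite_dimensional _ \<longleftrightarrow>
     (\<exists>Basis :: 'v set. finite_dimensional_vector_space scaleR Basis)"

definition skew_bilinear :: "('u::real_vector \<Rightarrow> 'u \<Rightarrow> 'v::real_vector) \<Rightarrow> bool" where
  "skew_bilinear \<beta> \<longleftrightarrow> bilinear \<beta> \<and> (\<forall>x y. \<beta> x y = - \<beta> y x)"

definition cyclic_sum :: "('u \<Rightarrow> 'u \<Rightarrow> 'u \<Rightarrow> 'v::real_vector) \<Rightarrow> 'u \<Rightarrow> 'u \<Rightarrow> 'u \<Rightarrow> 'v" where
  "cyclic_sum F x y z = F x y z + F y z x + F z x y"

definition lie_algebra :: "('g::real_vector \<Rightarrow> 'g \<Rightarrow> 'g) \<Rightarrow> bool" where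
  "lie_algebra br \<longleftrightarrow>
     finite_dimensional TYPE('g) \<and> skew_bilinear br \<and>
     (\<forall>x y z. cyclic_sum (\<lambda>x y z. br x (br y z)) x y z = 0)"

definition symplectic_lie_algebra ::
  "('a::real_vector \<Rightarrow> 'a \<Rightarrow> 'a) \<Rightarrow> ('a \<Rightarrow> 'a \<Rightarrow> real) \<Rightarrow> bool" where
  "symplectic_lie_algebra br \<omega> \<longleftrightarrow>
     lie_algebra br \<and> skew_bilinear \<omega> \<and>
     (\<forall>x. (\<forall>y. \<omega> x y = 0) \<longrightarrow> x = 0) \<and>
     (\<forall>x y z. cyclic_sum (\<lambda>x y z. \<omega> (br x y) z) x y z = 0)"

definition commutator :: "('v::real_vector \<Rightarrow> 'v) \<Rightarrow> ('v \<Rightarrow> 'v) \<Rightarrow> 'v \<Rightarrow> 'v" where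
  "commutator S T = (\<lambda>v. S (T v) - T (S v))"

text \<open>
  A linear map \<open>\<rho> : U \<rightarrow> gl(V)\<close> is rendered as a curried function: every \<open>\<rho> u\<close> is an
  endomorphism of \<open>V\<close>, and \<open>\<rho>\<close> is linear for the pointwise operations on \<open>gl(V)\<close>.
  Together these two requirements are exactly \<^const>\<open>bilinear\<close>.
\<close>

abbreviation (input) linear_to_gl :: "('u::real_vector \<Rightarrow> 'v::real_vector \<Rightarrow> 'v) \<Rightarrow> bool" where
  "linear_to_gl \<rho> \<equiv> bilinear \<rho>"

definition lie_representation ::
  "('a::real_vector \<Rightarrow> 'a \<Rightarrow> 'a) \<Rightarrow> ('a \<Rightarrow> 'v::real_vector \<Rightarrow> 'v) \<Rightarrow> bool" where
  "lie_representation br \<rho> \<longleftrightarrow>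
     linear_to_gl \<rho> \<and> (\<forall>x y. \<rho> (br x y) = commutator (\<rho> x) (\<rho> y))"

definition cocycles2 ::
  "('a::real_vector \<Rightarrow> 'a \<Rightarrow> 'a) \<Rightarrow> ('a \<Rightarrow> 'v::real_vector \<Rightarrow> 'v) \<Rightarrow> ('a \<Rightarrow> 'a \<Rightarrow> 'v) set" where
  "cocycles2 br \<rho> =
     {\<psi>. skew_bilinear \<psi> \<and>
         (\<forall>x y z. cyclic_sum (\<lambda>x y z. \<rho> x (\<psi> y z) + \<psi> x (br y z)) x y z = 0)}"

section \<open>The dual space\<close>

typedef (overloaded) ('b::real_vector) dual = "{f :: 'b \<Rightarrow> real. linear f}"
  morphisms dual_apply Dual
proof
  show "(\<lambda>_. 0) \<in> {f :: 'b \<Rightarrow> real. linear f}"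
    by (simp add: linear_iff)
qed

setup_lifting type_definition_dual

instantiation dual :: (real_vector) real_vector
begin

lift_definition zero_dual :: "'a dual" is "\<lambda>_. 0"
  by (simp add: linear_iff)

lift_definition plus_dual :: "'a dual \<Rightarrow> 'a dual \<Rightarrow> 'a dual" is "\<lambda>f g x. f x + g x"
  by (simp add: linear_iff algebra_simps)

lift_definition uminus_dual :: "'a dual \<Rightarrow> 'a dual" is "\<lambda>f x. - f x"
  by (simp add: linear_iff)

lift_definition minus_dual :: "'a dual \<Rightarrow> 'a dual \<Rightarrow> 'a dual" is "\<lambda>f g x. f x - g x"
  by (simp add: linear_iff algebra_simps)

lift_definition scaleR_dual :: "real \<Rightarrow> 'a dual \<Rightarrow> 'a dual" is "\<lambda>c f x. c * f x"
  by (simp add: linear_iff algebra_simps)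

instance
  by standard (transfer; simp add: fun_eq_iff algebra_simps)+

end

section \<open>The bracket on the sum of \<open>B\<close>, \<open>a\<close> and the dual of \<open>B\<close>\<close>

text \<open>
  An element \<open>b + a + f\<close> of the direct sum is the triple \<open>(b, a, f)\<close>.  The definition collects the
  prescribed values on the summands, extended by bilinearity and skew-symmetry; in particular
  \<open>[b\<^sub>1, a\<^sub>2]\<close> enters with a plus sign and \<open>[a\<^sub>1, b\<^sub>2] = - [b\<^sub>2, a\<^sub>1]\<close> with a minus sign.
  The lemmas below confirm the prescribed values.
\<close>

definition ext_bracket ::
  "('a::real_vector \<Rightarrow> 'a \<Rightarrow> 'a) \<Rightarrow> ('b::real_vector \<Rightarrow> 'b \<Rightarrow> 'b) \<Rightarrow>
   ('a \<Rightarrow> 'b dual \<Rightarrow> 'b dual) \<Rightarrow> ('a \<Rightarrow> 'a \<Rightarrow> 'b dual) \<Rightarrow>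
   ('a \<Rightarrow> 'b \<Rightarrow> 'b) \<Rightarrow> ('b \<Rightarrow> 'a \<Rightarrow> 'a) \<Rightarrow> ('b \<Rightarrow> 'b dual \<Rightarrow> 'b dual) \<Rightarrow>
   ('b \<Rightarrow> 'b \<Rightarrow> 'a) \<Rightarrow> ('b \<Rightarrow> 'b \<Rightarrow> 'b dual) \<Rightarrow> ('b \<Rightarrow> 'a \<Rightarrow> 'b dual) \<Rightarrow>
   'b \<times> 'a \<times> 'b dual \<Rightarrow> 'b \<times> 'a \<times> 'b dual \<Rightarrow> 'b \<times> 'a \<times> 'b dual" where
  "ext_bracket brA brB \<rho>1 \<psi> \<pi>1 \<pi>2 \<rho>2 \<Phi>1 \<Phi>2 \<Omega> = (\<lambda>(b1, a1, f1) (b2, a2, f2).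
     (brB b1 b2 - \<pi>1 a2 b1 + \<pi>1 a1 b2,
      \<Phi>1 b1 b2 + brA a1 a2 + \<pi>2 b1 a2 - \<pi>2 b2 a1,
      \<Phi>2 b1 b2 + \<psi> a1 a2 + \<Omega> b1 a2 - \<Omega> b2 a1
        + \<rho>1 a1 f2 - \<rho>1 a2 f1 + \<rho>2 b1 f2 - \<rho>2 b2 f1))"

context
  fixes brA :: "'a::real_vector \<Rightarrow> 'a \<Rightarrow> 'a" and brB :: "'b::real_vector \<Rightarrow> 'b \<Rightarrow> 'b"
    and \<rho>1 :: "'a \<Rightarrow> 'b dual \<Rightarrow> 'b dual" and \<psi> :: "'a \<Rightarrow> 'a \<Rightarrow> 'b dual"
    and \<pi>1 :: "'a \<Rightarrow> 'b \<Rightarrow> 'b" and \<pi>2 :: "'b \<Rightarrow> 'a \<Rightarrow> 'a" and \<rho>2 :: "'b \<Rightarrow> 'b dual \<Rightarrow> 'b dual"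
    and \<Phi>1 :: "'b \<Rightarrow> 'b \<Rightarrow> 'a" and \<Phi>2 :: "'b \<Rightarrow> 'b \<Rightarrow> 'b dual" and \<Omega> :: "'b \<Rightarrow> 'a \<Rightarrow> 'b dual"
  assumes skew: "skew_bilinear brA" "skew_bilinear brB" "skew_bilinear \<psi>"
      "skew_bilinear \<Phi>1" "skew_bilinear \<Phi>2"
    and bil: "bilinear \<rho>1" "bilinear \<pi>1" "bilinear \<pi>2" "bilinear \<rho>2" "bilinear \<Omega>"
begin

private abbreviation (input) "br \<equiv> ext_bracket brA brB \<rho>1 \<psi> \<pi>1 \<pi>2 \<rho>2 \<Phi>1 \<Phi>2 \<Omega>"

private lemmas bils = bil skew[unfolded skew_bilinear_def, THEN conjunct1]

private lemmas rules =
  bils[THEN bilinear_lzero] bils[THEN bilinear_rzero]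
  bils[THEN bilinear_ladd] bils[THEN bilinear_radd]
  bils[THEN bilinear_lmul] bils[THEN bilinear_rmul]

lemma ext_bracket_skew_bilinear: "skew_bilinear br"
proof -
  have anti: "br x y = - br y x" for x y
  proof (cases x; cases y)
    fix b1 a1 f1 b2 a2 f2
    assume "x = (b1, a1, f1)" "y = (b2, a2, f2)"
    moreover have "brA a1 a2 = - brA a2 a1" "brB b1 b2 = - brB b2 b1" "\<psi> a1 a2 = - \<psi> a2 a1"
      "\<Phi>1 b1 b2 = - \<Phi>1 b2 b1" "\<Phi>2 b1 b2 = - \<Phi>2 b2 b1"
      using skew unfolding skew_bilinear_def by blast+
    ultimately show ?thesis
      by (simp add: ext_bracket_def)
  qed
  have lin: "linear (br x)" for x
  proof (rule linearI)
    show "br x (y + z) = br x y + br x z" for y z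
      by (cases x; cases y; cases z) (simp add: ext_bracket_def rules)
    show "br x (c *\<^sub>R y) = c *\<^sub>R br x y" for c y
      by (cases x; cases y)
        (simp add: ext_bracket_def rules scaleR_add_right scaleR_diff_right)
  qed
  have "(\<lambda>x. br x y) = (\<lambda>x. - br y x)" for y
    by (rule ext) (rule anti)
  then have "linear (\<lambda>x. br x y)" for y
    using lin[of y] by (simp add: linear_compose_neg)
  with lin have "bilinear br"
    unfolding bilinear_def by blast
  with anti show ?thesis
    unfolding skew_bilinear_def by blast
qed

lemma ext_bracket_values:
  "br (b1, 0, 0) (b2, 0, 0) = (brB b1 b2, \<Phi>1 b1 b2, \<Phi>2 b1 b2)"
  "br (0, a1, 0) (0, a2, 0) = (0, brA a1 a2, \<psi> a1 a2)"
  "br (0, a, 0) (0, 0, f) = (0, 0, \<rho>1 a f)"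
  "br (b, 0, 0) (0, 0, f) = (0, 0, \<rho>2 b f)"
  "br (b, 0, 0) (0, a, 0) = (- \<pi>1 a b, \<pi>2 b a, \<Omega> b a)"
  "br (0, 0, f) (0, 0, f') = 0"
  by (simp_all add: ext_bracket_def rules zero_prod_def)

end

end

theory Submission
  imports Defs
begin

text \<open>
  The bracket is skew-symmetric and bilinear by construction and the total space is
  finite-dimensional, so being a Lie algebra amounts to the Jacobi identity, that is, to the
  vanishing of the Jacobiator \<open>[x, [y, z]] + [y, [z, x]] + [z, [x, y]]\<close>.  The Jacobiator is
  trilinear and alternating.  It therefore vanishes as soon as it does on triples of elements of
  the three summands \<open>B\<close>, \<open>a\<close>, \<open>B\<^sup>*\<close>, taken in this order
  (\<open>jacobiator_eq_0_sorted\<close>), which leaves ten kinds of triples.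

  On five of them, those of type \<open>aaa\<close>, \<open>aaB\<^sup>*\<close> and those with at least two entries in
  \<open>B\<^sup>*\<close>, it vanishes because \<open>a\<close> is a Lie algebra, \<open>\<rho>1\<close> a representation and \<open>\<psi>\<close> a
  cocycle.  On the other five, its components are up to sign the differences between the two
  sides of the stated conditions: type \<open>BaB\<^sup>*\<close> gives (C1), \<open>BBB\<close> gives (C2), \<open>BBa\<close> gives
  (C3), \<open>BBB\<^sup>*\<close> gives (C4) and \<open>Baa\<close> gives (C5).  In type \<open>BBB\<close> the Jacobi identity of
  \<open>B\<close> removes the remaining terms.
\<close>

section \<open>Finite dimension\<close>

lemma finite_dimensional_iff_finite_span:
  "finite_dimensional TYPE('v::real_vector) \<longleftrightarrow> (\<exists>S :: 'v set. finite S \<and> span S = UNIV)"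
proof
  assume "finite_dimensional TYPE('v)"
  then obtain Basis :: "'v set" where "finite_dimensional_vector_space scaleR Basis"
    unfolding finite_dimensional_def by blast
  then interpret fd: finite_dimensional_vector_space scaleR Basis .
  show "\<exists>S :: 'v set. finite S \<and> span S = UNIV"
    using fd.finite_Basis fd.span_Basis by (auto simp: span_raw_def)
next
  assume "\<exists>S :: 'v set. finite S \<and> span S = UNIV"
  then obtain S :: "'v set" where S: "finite S" "span S = UNIV" by blast
  obtain B where B: "B \<subseteq> S" "independent B" "S \<subseteq> span B"
    by (rule maximal_independent_subset)
  have "span S \<subseteq> span B"
    using B(3) by (rule span_minimal) simp
  then have "span B = UNIV" using S(2) by auto
  moreover have "finite B" using B(1) S(1) by (rule finite_subset)
  ultimately have "finite_dimensional_vector_space (scaleR :: real \<Rightarrow> 'v \<Rightarrow> 'v) B"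
    using B(2) by unfold_locales (simp_all add: span_raw_def dependent_raw_def)
  then show "finite_dimensional TYPE('v)"
    unfolding finite_dimensional_def by blast
qed

lemma finite_dimensional_prod:
  assumes "finite_dimensional TYPE('u::real_vector)" "finite_dimensional TYPE('v::real_vector)"
  shows "finite_dimensional TYPE('u \<times> 'v)"
proof -
  obtain S :: "'u set" and T :: "'v set"
    where S: "finite S" "span S = UNIV" and T: "finite T" "span T = UNIV"
    using assms unfolding finite_dimensional_iff_finite_span by blast
  let ?l = "\<lambda>x :: 'u. (x, 0 :: 'v)" and ?r = "\<lambda>y :: 'v. (0 :: 'u, y)"
  let ?G = "?l ` S \<union> ?r ` T"
  have lin: "linear ?l" "linear ?r" by (auto intro!: linearI)
  have "?l x \<in> span ?G" "?r y \<in> span ?G" for x y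
  proof -
    have "?l x \<in> ?l ` span S" "?r y \<in> ?r ` span T" using S T by auto
    then have "?l x \<in> span (?l ` S)" "?r y \<in> span (?r ` T)"
      by (simp_all add: linear_span_image[OF lin(1)] linear_span_image[OF lin(2)])
    then show "?l x \<in> span ?G" "?r y \<in> span ?G"
      by (meson span_mono subsetD sup_ge1 sup_ge2)+
  qed
  then have "?l x + ?r y \<in> span ?G" for x y by (intro span_add)
  then have "(x, y) \<in> span ?G" for x y by simp
  then have "span ?G = UNIV" by auto
  moreover have "finite ?G" using S T by simp
  ultimately show ?thesis unfolding finite_dimensional_iff_finite_span by blast
qed

lemma linear_dual_apply: "linear (dual_apply f)"
  using dual_apply[of f] by simp

lemma dual_apply_sum: "dual_apply (sum F S) x = (\<Sum>i\<in>S. dual_apply (F i) x)"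
  by (induction S rule: infinite_finite_induct) (simp_all add: zero_dual.rep_eq plus_dual.rep_eq)

text \<open>
  The coordinate functionals \<open>b\<^sup>*\<close> of a basis \<open>B\<close> span the dual, since
  \<open>f = (\<Sum>b\<in>B. f b \<cdot> b\<^sup>*)\<close>.
\<close>

lemma finite_dimensional_dual:
  assumes "finite_dimensional TYPE('b::real_vector)"
  shows "finite_dimensional TYPE('b dual)"
proof -
  obtain B :: "'b set" where "finite_dimensional_vector_space scaleR B"
    using assms unfolding finite_dimensional_def by blast
  then interpret fd: finite_dimensional_vector_space scaleR B .
  have B: "finite B" "independent B" "span B = UNIV"
    using fd.finite_Basis fd.independent_Basis fd.span_Basis
    by (simp_all add: span_raw_def dependent_raw_def)
  define coord where "coord b = Dual (\<lambda>x. representation B x b)" for b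
  have coord: "dual_apply (coord b) x = representation B x b" for b x
  proof -
    have "linear (\<lambda>x. representation B x b)"
      using B by (intro linearI) (simp_all add: representation_add representation_scale)
    then show ?thesis unfolding coord_def by (simp add: Dual_inverse)
  qed
  have "f = (\<Sum>b\<in>B. dual_apply f b *\<^sub>R coord b)" for f
  proof -
    have "dual_apply f x = dual_apply (\<Sum>b\<in>B. dual_apply f b *\<^sub>R coord b) x" for x
    proof -
      have "dual_apply f x = dual_apply f (\<Sum>b\<in>B. representation B x b *\<^sub>R b)"
        using B by (simp add: sum_representation_eq)
      also have "\<dots> = (\<Sum>b\<in>B. representation B x b * dual_apply f b)"
        by (simp add: linear_sum[OF linear_dual_apply] linear_cmul[OF linear_dual_apply])
      also have "\<dots> = dual_apply (\<Sum>b\<in>B. dual_apply f b *\<^sub>R coord b) x"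
        by (simp add: dual_apply_sum scaleR_dual.rep_eq coord mult.commute)
      finally show ?thesis .
    qed
    then show ?thesis by (intro dual_apply_inject[THEN iffD1] ext)
  qed
  then have "f \<in> span (coord ` B)" for f
    by (metis (no_types, lifting) imageI span_base span_scale span_sum)
  then have "span (coord ` B) = UNIV" by blast
  with B(1) show ?thesis unfolding finite_dimensional_iff_finite_span by blast
qed

section \<open>The Jacobiator\<close>

definition jacobiator :: "('g::real_vector \<Rightarrow> 'g \<Rightarrow> 'g) \<Rightarrow> 'g \<Rightarrow> 'g \<Rightarrow> 'g \<Rightarrow> 'g" where
  "jacobiator br = cyclic_sum (\<lambda>x y z. br x (br y z))"

lemma jacobiator_rotate: "jacobiator br y z x = jacobiator br x y z"
  by (simp add: jacobiator_def cyclic_sum_def algebra_simps)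

lemma jacobiator_swap:
  assumes "skew_bilinear br"
  shows "jacobiator br y x z = - jacobiator br x y z"
proof -
  have bil: "bilinear br" and skew: "\<And>x y. br x y = - br y x"
    using assms unfolding skew_bilinear_def by blast+
  have neg: "br u (br v w) = - br u (br w v)" for u v w
    by (subst skew[of v w]) (rule bilinear_rneg[OF bil])
  show ?thesis
    using neg[of y x z] neg[of x z y] neg[of z y x]
    by (simp add: jacobiator_def cyclic_sum_def)
qed

lemma linear_jacobiator:
  assumes "skew_bilinear br"
  shows "linear (jacobiator br x y)"
proof -
  have "bilinear br" using assms unfolding skew_bilinear_def by blast
  then show ?thesis
    by (intro linearI)
      (simp_all add: jacobiator_def cyclic_sum_def bilinear_ladd bilinear_radd
        bilinear_lmul bilinear_rmul scaleR_add_right)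
qed

text \<open>
  The Jacobiator of a skew bilinear bracket is trilinear and alternating.  So it suffices to test
  the Jacobi identity on a spanning union of subsets, and there on triples whose three
  subsets come in weakly increasing order: any other order is reached by a permutation of the
  arguments, which only changes the sign.
\<close>

lemma jacobiator_eq_0_sorted:
  fixes V :: "'i::linorder \<Rightarrow> 'g::real_vector set"
  assumes skew: "skew_bilinear br" and span: "span (\<Union>i. V i) = UNIV"
    and sorted: "\<And>i j k x y z. i \<le> j \<Longrightarrow> j \<le> k \<Longrightarrow> x \<in> V i \<Longrightarrow> y \<in> V j \<Longrightarrow> z \<in> V k \<Longrightarrow>
      jacobiator br x y z = 0"
  shows "jacobiator br x y z = 0"
proof -
  note rot = jacobiator_rotate[of br] and swap = jacobiator_swap[OF skew]
  have gen: "jacobiator br x y z = 0" if V: "x \<in> V i" "y \<in> V j" "z \<in> V k" for x y z i j k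
  proof -
    consider "i \<le> j" "j \<le> k" | "i \<le> k" "k \<le> j" | "j \<le> i" "i \<le> k"
      | "j \<le> k" "k \<le> i" | "k \<le> i" "i \<le> j" | "k \<le> j" "j \<le> i"
      by (meson linear)
    then show ?thesis
    proof cases
      case 1 then show ?thesis using sorted[of i j k x y z] V by simp
    next
      case 2 then show ?thesis using sorted[of i k j x z y] V rot[of x z y] swap[of y x z] by simp
    next
      case 3 then show ?thesis using sorted[of j i k y x z] V swap[of y x z] by simp
    next
      case 4 then show ?thesis using sorted[of j k i y z x] V rot[of y z x] by simp
    next
      case 5 then show ?thesis using sorted[of k i j z x y] V rot[of x y z] by simp
    next
      case 6 then show ?thesis
        using sorted[of k j i z y x] V rot[of z y x] rot[of x z y] swap[of y x z] by simp
    qed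
  qed
  let ?S = "\<Union>i. V i"
  have last: "jacobiator br x y z = 0" if "\<And>w. w \<in> ?S \<Longrightarrow> jacobiator br x y w = 0" for x y z
    using linear_eq_0_on_span[OF linear_jacobiator[OF skew], of ?S x y z] that span by auto
  have two: "jacobiator br u v w = 0" if "u \<in> ?S" "v \<in> ?S" for u v w
  proof (rule last)
    show "jacobiator br u v t = 0" if "t \<in> ?S" for t
      using that \<open>u \<in> ?S\<close> \<open>v \<in> ?S\<close> by (auto intro: gen)
  qed
  have one: "jacobiator br w u v = 0" if "u \<in> ?S" for u v w
  proof (rule last)
    show "jacobiator br w u t = 0" if "t \<in> ?S" for t
      using two[OF \<open>u \<in> ?S\<close> that, of w] unfolding rot[of u t w] .
  qed
  show ?thesis
  proof (rule last)
    show "jacobiator br x y t = 0" if "t \<in> ?S" for t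
      using one[OF that, of y x] unfolding rot[of y t x] .
  qed
qed

section \<open>The Jacobiator on the summands\<close>

locale extension_data =
  fixes brA :: "'a::real_vector \<Rightarrow> 'a \<Rightarrow> 'a" and brB :: "'b::real_vector \<Rightarrow> 'b \<Rightarrow> 'b"
    and \<rho>1 :: "'a \<Rightarrow> 'b dual \<Rightarrow> 'b dual" and \<psi> :: "'a \<Rightarrow> 'a \<Rightarrow> 'b dual"
    and \<pi>1 :: "'a \<Rightarrow> 'b \<Rightarrow> 'b" and \<pi>2 :: "'b \<Rightarrow> 'a \<Rightarrow> 'a" and \<rho>2 :: "'b \<Rightarrow> 'b dual \<Rightarrow> 'b dual"
    and \<Phi>1 :: "'b \<Rightarrow> 'b \<Rightarrow> 'a" and \<Phi>2 :: "'b \<Rightarrow> 'b \<Rightarrow> 'b dual" and \<Omega> :: "'b \<Rightarrow> 'a \<Rightarrow> 'b dual"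
  assumes lieA: "lie_algebra brA" and lieB: "lie_algebra brB"
    and rep: "lie_representation brA \<rho>1" and cocycle: "\<psi> \<in> cocycles2 brA \<rho>1"
    and bil: "bilinear \<pi>1" "bilinear \<pi>2" "bilinear \<rho>2" "bilinear \<Omega>"
    and skew: "skew_bilinear \<Phi>1" "skew_bilinear \<Phi>2"
begin

abbreviation (input) "br \<equiv> ext_bracket brA brB \<rho>1 \<psi> \<pi>1 \<pi>2 \<rho>2 \<Phi>1 \<Phi>2 \<Omega>"

lemma skew_bilinears:
  "skew_bilinear brA" "skew_bilinear brB" "skew_bilinear \<psi>" "skew_bilinear \<Phi>1" "skew_bilinear \<Phi>2"
  using lieA lieB cocycle skew by (simp_all add: lie_algebra_def cocycles2_def)

lemma bilinear_rho1: "bilinear \<rho>1"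
  using rep by (simp add: lie_representation_def)

lemmas bilinears = bil bilinear_rho1 skew_bilinears[unfolded skew_bilinear_def, THEN conjunct1]

lemmas bilinear_rules =
  bilinears[THEN bilinear_lzero] bilinears[THEN bilinear_rzero]
  bilinears[THEN bilinear_lneg] bilinears[THEN bilinear_rneg]

lemmas skews = skew_bilinears[unfolded skew_bilinear_def, THEN conjunct2, rule_format]

lemma skew_bilinear_br: "skew_bilinear br"
  by (rule ext_bracket_skew_bilinear) (use skew_bilinears bilinear_rho1 bil in simp_all)

lemma finite_dimensional_total: "finite_dimensional TYPE('b \<times> 'a \<times> 'b dual)"
  using lieA lieB
  by (intro finite_dimensional_prod finite_dimensional_dual) (simp_all add: lie_algebra_def)

lemma jacobiA: "cyclic_sum (\<lambda>x y z. brA x (brA y z)) x y z = 0"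
  using lieA by (simp add: lie_algebra_def)

lemma jacobiB: "cyclic_sum (\<lambda>x y z. brB x (brB y z)) x y z = 0"
  using lieB by (simp add: lie_algebra_def)

lemmas jacobiator_simps = jacobiator_def cyclic_sum_def ext_bracket_def bilinear_rules commutator_def

text \<open>
  Every component below is arranged as plus or minus \<open>l - r\<close>, where \<open>l = r\<close> is the condition it
  encodes (with \<open>r = 0\<close> in the \<open>B\<close>-component of type \<open>BBB\<close>).  The vanishing of the Jacobiator
  on a type of triples then becomes the corresponding condition by cancelling signs and
  differences, with no rearrangement of terms.
\<close>

lemma jacobiator_BBB:
  "jacobiator br (b1, 0, 0) (b2, 0, 0) (b3, 0, 0) =
    (- cyclic_sum (\<lambda>b1 b2 b3. \<pi>1 (\<Phi>1 b1 b2) b3) b1 b2 b3,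
     cyclic_sum (\<lambda>b1 b2 b3. \<Phi>1 b1 (brB b2 b3)) b1 b2 b3
       - (- cyclic_sum (\<lambda>b1 b2 b3. \<pi>2 b1 (\<Phi>1 b2 b3)) b1 b2 b3),
     cyclic_sum (\<lambda>b1 b2 b3. \<Phi>2 b1 (brB b2 b3)) b1 b2 b3
       - (- cyclic_sum (\<lambda>b1 b2 b3. \<rho>2 b1 (\<Phi>2 b2 b3)) b1 b2 b3
          - cyclic_sum (\<lambda>b1 b2 b3. \<Omega> b1 (\<Phi>1 b2 b3)) b1 b2 b3))"
  using jacobiB[of b1 b2 b3] by (simp add: jacobiator_simps algebra_simps)

lemma jacobiator_BBA:
  "jacobiator br (b1, 0, 0) (b2, 0, 0) (0, a, 0) =
    ((\<pi>1 a (brB b1 b2) - brB (\<pi>1 a b1) b2 - brB b1 (\<pi>1 a b2))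
       - (\<pi>1 (\<pi>2 b2 a) b1 - \<pi>1 (\<pi>2 b1 a) b2),
     - ((\<Phi>1 (\<pi>1 a b1) b2 + \<Phi>1 b1 (\<pi>1 a b2) - brA a (\<Phi>1 b1 b2))
          - (commutator (\<pi>2 b1) (\<pi>2 b2) a - \<pi>2 (brB b1 b2) a)),
     (\<psi> a (\<Phi>1 b1 b2) + \<rho>2 b1 (\<Omega> b2 a) - \<rho>2 b2 (\<Omega> b1 a))
       - (\<Phi>2 (\<pi>1 a b1) b2 + \<Phi>2 b1 (\<pi>1 a b2) - \<rho>1 a (\<Phi>2 b1 b2)
           + \<Omega> (brB b1 b2) a - \<Omega> b1 (\<pi>2 b2 a) + \<Omega> b2 (\<pi>2 b1 a)))"
  using skews(2)[of "\<pi>1 a b1" b2] skews(4)[of "\<pi>1 a b1" b2] skews(5)[of "\<pi>1 a b1" b2]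
  by (simp add: jacobiator_simps algebra_simps)

lemma jacobiator_BBF:
  "jacobiator br (b1, 0, 0) (b2, 0, 0) (0, 0, f) =
    (0, 0, (commutator (\<rho>2 b1) (\<rho>2 b2) f - \<rho>2 (brB b1 b2) f) - \<rho>1 (\<Phi>1 b1 b2) f)"
  by (simp add: jacobiator_simps algebra_simps)

lemma jacobiator_BAA:
  "jacobiator br (b, 0, 0) (0, a1, 0) (0, a2, 0) =
    (- (\<pi>1 (brA a1 a2) b - commutator (\<pi>1 a1) (\<pi>1 a2) b),
     (\<pi>2 b (brA a1 a2) - brA (\<pi>2 b a1) a2 - brA a1 (\<pi>2 b a2))
       - (\<pi>2 (\<pi>1 a2 b) a1 - \<pi>2 (\<pi>1 a1 b) a2),
     - ((\<psi> (\<pi>2 b a1) a2 + \<psi> a1 (\<pi>2 b a2) - \<rho>2 b (\<psi> a1 a2))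
          - (\<rho>1 a2 (\<Omega> b a1) - \<rho>1 a1 (\<Omega> b a2) + \<Omega> b (brA a1 a2)
               + \<Omega> (\<pi>1 a1 b) a2 - \<Omega> (\<pi>1 a2 b) a1)))"
  using skews(1)[of "\<pi>2 b a1" a2] skews(3)[of "\<pi>2 b a1" a2]
  by (simp add: jacobiator_simps algebra_simps)

lemma jacobiator_BAF:
  "jacobiator br (b, 0, 0) (0, a, 0) (0, 0, f) =
    (0, 0, - (commutator (\<rho>1 a) (\<rho>2 b) f - (\<rho>2 (\<pi>1 a b) f - \<rho>1 (\<pi>2 b a) f)))"
  by (simp add: jacobiator_simps algebra_simps)

text \<open>
  On the remaining kinds of triples the Jacobi identity holds outright: for three arguments
  from \<open>a\<close> it is the Jacobi identity of \<open>a\<close> together with the cocycle condition, for two from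
  \<open>a\<close> and one from the dual it says that \<open>\<rho>1\<close> is a representation, and with two from the dual
  every term vanishes, since the dual is an abelian ideal.
\<close>

lemma jacobiator_AAA: "jacobiator br (0, a1, 0) (0, a2, 0) (0, a3, 0) = 0"
proof -
  have "cyclic_sum (\<lambda>x y z. \<rho>1 x (\<psi> y z) + \<psi> x (brA y z)) a1 a2 a3 = 0"
    using cocycle by (simp add: cocycles2_def)
  then show ?thesis
    using jacobiA[of a1 a2 a3] by (simp add: jacobiator_simps algebra_simps zero_prod_def)
qed

lemma jacobiator_AAF: "jacobiator br (0, a1, 0) (0, a2, 0) (0, 0, f) = 0"
proof -
  have "\<rho>1 (brA a1 a2) f = commutator (\<rho>1 a1) (\<rho>1 a2) f"
    using rep by (simp add: lie_representation_def)
  then show ?thesis by (simp add: jacobiator_simps zero_prod_def)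
qed

lemma jacobiator_FF: "jacobiator br x (0, 0, f) (0, 0, f') = 0"
  by (cases x) (simp add: jacobiator_simps zero_prod_def)

lemma jacobiator_eq_0_iff_summands:
  "(\<forall>x y z. jacobiator br x y z = 0) \<longleftrightarrow>
    (\<forall>b1 b2 b3. jacobiator br (b1, 0, 0) (b2, 0, 0) (b3, 0, 0) = 0) \<and>
    (\<forall>b1 b2 a. jacobiator br (b1, 0, 0) (b2, 0, 0) (0, a, 0) = 0) \<and>
    (\<forall>b1 b2 f. jacobiator br (b1, 0, 0) (b2, 0, 0) (0, 0, f) = 0) \<and>
    (\<forall>b a1 a2. jacobiator br (b, 0, 0) (0, a1, 0) (0, a2, 0) = 0) \<and>
    (\<forall>b a f. jacobiator br (b, 0, 0) (0, a, 0) (0, 0, f) = 0)"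
  (is "?L \<longleftrightarrow> ?R")
proof
  assume ?R
  \<comment> \<open>The summands are indexed by \<open>0\<close>, \<open>1\<close> and, so that the index type can be \<open>nat\<close>, any larger
    number for the dual.\<close>
  define V :: "nat \<Rightarrow> ('b \<times> 'a \<times> 'b dual) set" where
    "V i = (if i = 0 then range (\<lambda>b. (b, 0, 0)) else if i = 1 then range (\<lambda>a. (0, a, 0))
            else range (\<lambda>f. (0, 0, f)))" for i
  have "(b, a, f) \<in> span (\<Union>i. V i)" for b a f
  proof -
    have "(b, 0, 0) \<in> V 0" "(0, a, 0) \<in> V 1" "(0, 0, f) \<in> V 2"
      by (simp_all add: V_def)
    then have "(b, 0, 0) + (0, a, 0) + (0, 0, f) \<in> span (\<Union>i. V i)"
      by (intro span_add span_base) blast+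
    then show ?thesis by simp
  qed
  then have "span (\<Union>i. V i) = UNIV" by auto
  moreover have "jacobiator br x y z = 0"
    if "i \<le> j" "j \<le> k" "x \<in> V i" "y \<in> V j" "z \<in> V k" for i j k x y z
    using that \<open>?R\<close>
    by (auto simp: V_def jacobiator_AAA jacobiator_AAF jacobiator_FF split: if_splits)
  ultimately have "jacobiator br x y z = 0" for x y z
    by (rule jacobiator_eq_0_sorted[OF skew_bilinear_br])
  then show ?L by blast
qed blast

lemma lie_algebra_iff_jacobiator: "lie_algebra br \<longleftrightarrow> (\<forall>x y z. jacobiator br x y z = 0)"
  using finite_dimensional_total skew_bilinear_br
  by (simp add: lie_algebra_def jacobiator_def)

end

theorem proposition2p2:
  fixes brA :: "'a::real_vector \<Rightarrow> 'a \<Rightarrow> 'a" and \<omega> :: "'a \<Rightarrow> 'a \<Rightarrow> real"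
    and brB :: "'b::real_vector \<Rightarrow> 'b \<Rightarrow> 'b"
    and \<rho>1 :: "'a \<Rightarrow> 'b dual \<Rightarrow> 'b dual" and \<psi> :: "'a \<Rightarrow> 'a \<Rightarrow> 'b dual"
    and \<pi>1 :: "'a \<Rightarrow> 'b \<Rightarrow> 'b" and \<pi>2 :: "'b \<Rightarrow> 'a \<Rightarrow> 'a" and \<rho>2 :: "'b \<Rightarrow> 'b dual \<Rightarrow> 'b dual"
    and \<Phi>1 :: "'b \<Rightarrow> 'b \<Rightarrow> 'a" and \<Phi>2 :: "'b \<Rightarrow> 'b \<Rightarrow> 'b dual" and \<Omega> :: "'b \<Rightarrow> 'a \<Rightarrow> 'b dual"
  assumes "symplectic_lie_algebra brA \<omega>"
    and "lie_algebra brB"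
    and "lie_representation brA \<rho>1"
    and "\<psi> \<in> cocycles2 brA \<rho>1"
    and "linear_to_gl \<pi>1" and "linear_to_gl \<pi>2" and "linear_to_gl \<rho>2"
    and "skew_bilinear \<Phi>1" and "skew_bilinear \<Phi>2"
    and "bilinear \<Omega>"
  shows "lie_algebra (ext_bracket brA brB \<rho>1 \<psi> \<pi>1 \<pi>2 \<rho>2 \<Phi>1 \<Phi>2 \<Omega>) \<longleftrightarrow>
    \<comment> \<open>(C1)\<close>
    (\<forall>a b. commutator (\<rho>1 a) (\<rho>2 b) = (\<lambda>f. \<rho>2 (\<pi>1 a b) f - \<rho>1 (\<pi>2 b a) f)) \<and>
    \<comment> \<open>(C2)\<close>
    (\<forall>b1 b2 b3.
       cyclic_sum (\<lambda>b1 b2 b3. \<pi>1 (\<Phi>1 b1 b2) b3) b1 b2 b3 = 0 \<and>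
       cyclic_sum (\<lambda>b1 b2 b3. \<Phi>1 b1 (brB b2 b3)) b1 b2 b3
         = - cyclic_sum (\<lambda>b1 b2 b3. \<pi>2 b1 (\<Phi>1 b2 b3)) b1 b2 b3 \<and>
       cyclic_sum (\<lambda>b1 b2 b3. \<Phi>2 b1 (brB b2 b3)) b1 b2 b3
         = - cyclic_sum (\<lambda>b1 b2 b3. \<rho>2 b1 (\<Phi>2 b2 b3)) b1 b2 b3
           - cyclic_sum (\<lambda>b1 b2 b3. \<Omega> b1 (\<Phi>1 b2 b3)) b1 b2 b3) \<and>
    \<comment> \<open>(C3)\<close>
    (\<forall>a b1 b2.
       \<pi>1 a (brB b1 b2) - brB (\<pi>1 a b1) b2 - brB b1 (\<pi>1 a b2)
         = \<pi>1 (\<pi>2 b2 a) b1 - \<pi>1 (\<pi>2 b1 a) b2 \<and>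
       \<Phi>1 (\<pi>1 a b1) b2 + \<Phi>1 b1 (\<pi>1 a b2) - brA a (\<Phi>1 b1 b2)
         = commutator (\<pi>2 b1) (\<pi>2 b2) a - \<pi>2 (brB b1 b2) a \<and>
       \<psi> a (\<Phi>1 b1 b2) + \<rho>2 b1 (\<Omega> b2 a) - \<rho>2 b2 (\<Omega> b1 a)
         = \<Phi>2 (\<pi>1 a b1) b2 + \<Phi>2 b1 (\<pi>1 a b2) - \<rho>1 a (\<Phi>2 b1 b2)
           + \<Omega> (brB b1 b2) a - \<Omega> b1 (\<pi>2 b2 a) + \<Omega> b2 (\<pi>2 b1 a)) \<and>
    \<comment> \<open>(C4)\<close>
    (\<forall>b1 b2. (\<lambda>f. commutator (\<rho>2 b1) (\<rho>2 b2) f - \<rho>2 (brB b1 b2) f) = \<rho>1 (\<Phi>1 b1 b2)) \<and>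
    \<comment> \<open>(C5)\<close>
    lie_representation brA \<pi>1 \<and>
    (\<forall>a1 a2 b.
       \<pi>2 b (brA a1 a2) - brA (\<pi>2 b a1) a2 - brA a1 (\<pi>2 b a2)
         = \<pi>2 (\<pi>1 a2 b) a1 - \<pi>2 (\<pi>1 a1 b) a2 \<and>
       \<psi> (\<pi>2 b a1) a2 + \<psi> a1 (\<pi>2 b a2) - \<rho>2 b (\<psi> a1 a2)
         = \<rho>1 a2 (\<Omega> b a1) - \<rho>1 a1 (\<Omega> b a2) + \<Omega> b (brA a1 a2)
           + \<Omega> (\<pi>1 a1 b) a2 - \<Omega> (\<pi>1 a2 b) a1)"
proof -
  interpret extension_data brA brB \<rho>1 \<psi> \<pi>1 \<pi>2 \<rho>2 \<Phi>1 \<Phi>2 \<Omega>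
    using assms by unfold_locales (simp_all add: symplectic_lie_algebra_def)
  \<comment> \<open>The Jacobiator is evaluated on the summands first: splitting the pair \<open>0\<close> into components
    earlier would also split the \<open>0\<close> in the statement about general triples.\<close>
  show ?thesis
    unfolding lie_algebra_iff_jacobiator jacobiator_eq_0_iff_summands
    unfolding jacobiator_BBB jacobiator_BBA jacobiator_BBF jacobiator_BAA jacobiator_BAF
      zero_prod_def prod.inject neg_equal_0_iff_equal right_minus_eq
      lie_representation_def fun_eq_iff
    using assms(5) by blast
qed

end
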